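(* Let $k$ be a field of characteristic $0$. Every transposed Poisson algebra $(A,\cdot,[\cdot,\cdot])$ over $k$ is an $F$-manifold algebra.
   Context: All algebras are over a field of characteristic $0$. A transposed Poisson algebra is a vector space with a commutative associative bilinear product $\cdot$ and a Lie bracket $[\cdot,\cdot]$ satisfying for all $x_1,x_2,x_3$ $$2[x_1,x_2]\cdot x_3=[x_1\cdot x_3,x_2]+[x_1,x_2\cdot x_3].$$ An $F$-manifold algebra is a vector space with a commutative associative bilinear product $\cdot$ and a Lie bracket $[\cdot,\cdot]$ satisfying for all $a_1,a_2,a_3,a_4$ $$[a_1\cdot a_2,a_3\cdot a_4]=[a_1\cdot a_2,a_3]\cdot a_4+[a_1\cdot a_2,a_4]\cdot a_3+a_1\cdot[a_2,a_3\cdot a_4]+a_2\cdot[a_1,a_3\cdot a_4]$$ $$\qquad-(a_1\cdot a_3)\cdot[a_2,a_4]-(a_2\cdot a_3)\cdot[a_1,a_4]-(a_2\cdot a_4)\cdot[a_1,a_3]-(a_1\cdot a_4)\cdot[a_2,a_3].$$ *)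

theory Defs
  imports Complex_Main
begin

text \<open>Vector spaces are given by the locale \<open>vector_space\<close>, with the whole type \<open>'a\<close> as
  underlying set. None of the algebras is assumed to have a unit or to be finite-dimensional.\<close>

locale bilinear_product = vector_space scale
  for scale :: "'k::field_char_0 \<Rightarrow> 'a::ab_group_add \<Rightarrow> 'a" +
  fixes m :: "'a \<Rightarrow> 'a \<Rightarrow> 'a"
  assumes linear_left: "Vector_Spaces.linear scale scale (\<lambda>x. m x y)"
    and linear_right: "Vector_Spaces.linear scale scale (\<lambda>y. m x y)"

locale comm_assoc_algebra = bilinear_product scale mult
  for scale :: "'k::field_char_0 \<Rightarrow> 'a::ab_group_add \<Rightarrow> 'a"
    and mult :: "'a \<Rightarrow> 'a \<Rightarrow> 'a" +
  assumes mult_commute: "mult x y = mult y x"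
    and mult_assoc: "mult (mult x y) z = mult x (mult y z)"

locale lie_algebra = bilinear_product scale bracket
  for scale :: "'k::field_char_0 \<Rightarrow> 'a::ab_group_add \<Rightarrow> 'a"
    and bracket :: "'a \<Rightarrow> 'a \<Rightarrow> 'a" +
  assumes bracket_self: "bracket x x = 0"
    and jacobi:
      "bracket x (bracket y z) + bracket y (bracket z x) + bracket z (bracket x y) = 0"

locale transposed_poisson_algebra =
  comm_assoc_algebra scale mult + lie_algebra scale bracket
  for scale :: "'k::field_char_0 \<Rightarrow> 'a::ab_group_add \<Rightarrow> 'a"
    and mult :: "'a \<Rightarrow> 'a \<Rightarrow> 'a" (infixl "\<cdot>" 70)
    and bracket :: "'a \<Rightarrow> 'a \<Rightarrow> 'a" ("\<lbrakk>_,/ _\<rbrakk>") +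
  assumes transposed_leibniz:
    "scale 2 (\<lbrakk>x1, x2\<rbrakk> \<cdot> x3) = \<lbrakk>x1 \<cdot> x3, x2\<rbrakk> + \<lbrakk>x1, x2 \<cdot> x3\<rbrakk>"

locale F_manifold_algebra =
  comm_assoc_algebra scale mult + lie_algebra scale bracket
  for scale :: "'k::field_char_0 \<Rightarrow> 'a::ab_group_add \<Rightarrow> 'a"
    and mult :: "'a \<Rightarrow> 'a \<Rightarrow> 'a" (infixl "\<cdot>" 70)
    and bracket :: "'a \<Rightarrow> 'a \<Rightarrow> 'a" ("\<lbrakk>_,/ _\<rbrakk>") +
  assumes hertling_manin:
    "\<lbrakk>a1 \<cdot> a2, a3 \<cdot> a4\<rbrakk> =
       \<lbrakk>a1 \<cdot> a2, a3\<rbrakk> \<cdot> a4 + \<lbrakk>a1 \<cdot> a2, a4\<rbrakk> \<cdot> a3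
       + a1 \<cdot> \<lbrakk>a2, a3 \<cdot> a4\<rbrakk> + a2 \<cdot> \<lbrakk>a1, a3 \<cdot> a4\<rbrakk>
       - (a1 \<cdot> a3) \<cdot> \<lbrakk>a2, a4\<rbrakk> - (a2 \<cdot> a3) \<cdot> \<lbrakk>a1, a4\<rbrakk>
       - (a2 \<cdot> a4) \<cdot> \<lbrakk>a1, a3\<rbrakk> - (a1 \<cdot> a4) \<cdot> \<lbrakk>a2, a3\<rbrakk>"

end

theory Submission imports Defs begin

text \<open>The transposed Leibniz rule says that a bracket times \<open>u\<close> is half the sum of the two brackets
  obtained by inserting \<open>u\<close> into one of its slots. Associativity offers two ways to expand \<open>u \<cdot> v \<cdot> [x, y]\<close>: by the
  rule for \<open>u\<close> and for \<open>v\<close> in succession, or by the rule for the single element \<open>u \<cdot> v\<close>.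
  Comparing them gives
  \<open>2 (u \<cdot> v \<cdot> [x, y]) = [x \<cdot> u, y \<cdot> v] + [x \<cdot> v, y \<cdot> u]\<close>.
  Two instances of this identity, in which the second terms cancel by antisymmetry, evaluate
  \<open>L = [a1 \<cdot> a2, a3 \<cdot> a4]\<close> as \<open>a2 \<cdot> a4 \<cdot> [a1, a3] + a1 \<cdot> a3 \<cdot> [a2, a4]\<close>, and exchanging \<open>a3\<close> with
  \<open>a4\<close> gives a second such expression. Hence the four negative terms of the Hertling--Manin
  relation add up to \<open>- 2 L\<close>. Twice each of the four positive terms is, by the rule, \<open>L\<close> plus a
  bracket with three factors on one side; these four extra brackets are regrouped by the rule into
  \<open>2 (a2 \<cdot> a4 \<cdot> [a1, a3]) + 2 (a1 \<cdot> a3 \<cdot> [a2, a4]) = 2 L\<close>. Twice the right-hand side is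
  thus \<open>4 L + 2 L - 4 L = 2 L\<close>, and 2 is invertible.\<close>

lemma (in vector_space) scale_two: "scale 2 x = x + x"
  by (metis one_add_one scale_left_distrib scale_one)

lemma (in comm_assoc_algebra) mult_add_right: "mult x (y + z) = mult x y + mult x z"
  using linear_right[of x] by (simp add: Vector_Spaces.linear_iff)

text \<open>Polarisation of \<open>[x, x] = 0\<close>.\<close>
lemma (in lie_algebra) bracket_swap: "bracket x y = - bracket y x"
proof -
  have left: "bracket (u + v) w = bracket u w + bracket v w" for u v w
    using linear_left[of w] by (simp add: Vector_Spaces.linear_iff)
  have right: "bracket u (v + w) = bracket u v + bracket u w" for u v w
    using linear_right[of u] by (simp add: Vector_Spaces.linear_iff)
  have "bracket (x + y) (x + y) = bracket x y + bracket y x"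
    unfolding left right by (simp add: bracket_self)
  then have "bracket x y + bracket y x = 0"
    by (simp add: bracket_self)
  then show ?thesis
    by (simp add: eq_neg_iff_add_eq_0)
qed

context transposed_poisson_algebra
begin

lemma mult_left_commute: "x \<cdot> (y \<cdot> z) = y \<cdot> (x \<cdot> z)"
  by (metis mult_assoc mult_commute)

lemmas mult_ac = mult_assoc mult_commute mult_left_commute

lemma double_cancel:
  assumes "(x::'a) + x = y + y"
  shows "x = y"
proof -
  have "scale 2 x = scale 2 y"
    using assms by (simp add: scale_two)
  then show ?thesis
    by simp
qed

lemma double_mult_bracket:
  "z \<cdot> \<lbrakk>x, y\<rbrakk> + z \<cdot> \<lbrakk>x, y\<rbrakk> = \<lbrakk>z \<cdot> x, y\<rbrakk> + \<lbrakk>x, z \<cdot> y\<rbrakk>"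
  using transposed_leibniz[of x y z] by (simp add: scale_two mult_commute)

text \<open>Four times \<open>u \<cdot> v \<cdot> [x, y]\<close> is the sum of all four brackets that arise by inserting \<open>u\<close> and
  \<open>v\<close> separately, while inserting the product \<open>u \<cdot> v\<close> shows that the two of them in which \<open>u\<close>
  and \<open>v\<close> lie in the same slot account for half of it.\<close>
lemma double_mult_mult_bracket:
  "u \<cdot> (v \<cdot> \<lbrakk>x, y\<rbrakk>) + u \<cdot> (v \<cdot> \<lbrakk>x, y\<rbrakk>) = \<lbrakk>u \<cdot> x, v \<cdot> y\<rbrakk> + \<lbrakk>v \<cdot> x, u \<cdot> y\<rbrakk>"
proof -
  let ?t = "u \<cdot> (v \<cdot> \<lbrakk>x, y\<rbrakk>)"
  have "?t + ?t = u \<cdot> \<lbrakk>v \<cdot> x, y\<rbrakk> + u \<cdot> \<lbrakk>x, v \<cdot> y\<rbrakk>"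
    using double_mult_bracket[of v x y] by (metis mult_add_right)
  then have "(?t + ?t) + (?t + ?t) =
      (u \<cdot> \<lbrakk>v \<cdot> x, y\<rbrakk> + u \<cdot> \<lbrakk>v \<cdot> x, y\<rbrakk>) + (u \<cdot> \<lbrakk>x, v \<cdot> y\<rbrakk> + u \<cdot> \<lbrakk>x, v \<cdot> y\<rbrakk>)"
    by (simp add: algebra_simps)
  also have "\<dots> = (\<lbrakk>u \<cdot> (v \<cdot> x), y\<rbrakk> + \<lbrakk>x, u \<cdot> (v \<cdot> y)\<rbrakk>) + (\<lbrakk>u \<cdot> x, v \<cdot> y\<rbrakk> + \<lbrakk>v \<cdot> x, u \<cdot> y\<rbrakk>)"
    by (simp add: double_mult_bracket algebra_simps)
  also have "\<lbrakk>u \<cdot> (v \<cdot> x), y\<rbrakk> + \<lbrakk>x, u \<cdot> (v \<cdot> y)\<rbrakk> = ?t + ?t"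
    using double_mult_bracket[of "u \<cdot> v" x y] by (simp add: mult_assoc)
  finally show ?thesis
    by simp
qed

text \<open>The two instances of the previous identity contain the opposite brackets
  \<open>[a1 \<cdot> a4, a2 \<cdot> a3]\<close> and \<open>[a2 \<cdot> a3, a1 \<cdot> a4]\<close>, which cancel in their sum.\<close>
lemma bracket_mult_mult:
  "\<lbrakk>a1 \<cdot> a2, a3 \<cdot> a4\<rbrakk> = a2 \<cdot> (a4 \<cdot> \<lbrakk>a1, a3\<rbrakk>) + a1 \<cdot> (a3 \<cdot> \<lbrakk>a2, a4\<rbrakk>)"
proof (rule double_cancel)
  have "a2 \<cdot> (a4 \<cdot> \<lbrakk>a1, a3\<rbrakk>) + a2 \<cdot> (a4 \<cdot> \<lbrakk>a1, a3\<rbrakk>) = \<lbrakk>a1 \<cdot> a2, a3 \<cdot> a4\<rbrakk> + \<lbrakk>a1 \<cdot> a4, a2 \<cdot> a3\<rbrakk>"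
    using double_mult_mult_bracket[of a2 a4 a1 a3] by (simp add: mult_commute)
  moreover have "a1 \<cdot> (a3 \<cdot> \<lbrakk>a2, a4\<rbrakk>) + a1 \<cdot> (a3 \<cdot> \<lbrakk>a2, a4\<rbrakk>) =
      \<lbrakk>a1 \<cdot> a2, a3 \<cdot> a4\<rbrakk> - \<lbrakk>a1 \<cdot> a4, a2 \<cdot> a3\<rbrakk>"
    using double_mult_mult_bracket[of a1 a3 a2 a4] bracket_swap[of "a1 \<cdot> a4" "a2 \<cdot> a3"]
    by (simp add: mult_commute)
  ultimately show "\<lbrakk>a1 \<cdot> a2, a3 \<cdot> a4\<rbrakk> + \<lbrakk>a1 \<cdot> a2, a3 \<cdot> a4\<rbrakk> =
      (a2 \<cdot> (a4 \<cdot> \<lbrakk>a1, a3\<rbrakk>) + a1 \<cdot> (a3 \<cdot> \<lbrakk>a2, a4\<rbrakk>)) + (a2 \<cdot> (a4 \<cdot> \<lbrakk>a1, a3\<rbrakk>) + a1 \<cdot> (a3 \<cdot> \<lbrakk>a2, a4\<rbrakk>))"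
    by (simp add: algebra_simps)
qed

lemma hertling_manin_relation:
  "\<lbrakk>a1 \<cdot> a2, a3 \<cdot> a4\<rbrakk> =
     \<lbrakk>a1 \<cdot> a2, a3\<rbrakk> \<cdot> a4 + \<lbrakk>a1 \<cdot> a2, a4\<rbrakk> \<cdot> a3
     + a1 \<cdot> \<lbrakk>a2, a3 \<cdot> a4\<rbrakk> + a2 \<cdot> \<lbrakk>a1, a3 \<cdot> a4\<rbrakk>
     - (a1 \<cdot> a3) \<cdot> \<lbrakk>a2, a4\<rbrakk> - (a2 \<cdot> a3) \<cdot> \<lbrakk>a1, a4\<rbrakk>
     - (a2 \<cdot> a4) \<cdot> \<lbrakk>a1, a3\<rbrakk> - (a1 \<cdot> a4) \<cdot> \<lbrakk>a2, a3\<rbrakk>"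
proof -
  \<comment> \<open>Naming the terms turns the relation into a linear consequence of the equations below: \<open>p\<close>
    and \<open>n\<close> are the positive and negative terms, \<open>b\<close> the brackets with three factors in a slot.\<close>
  define L where "L = \<lbrakk>a1 \<cdot> a2, a3 \<cdot> a4\<rbrakk>"
  define p1 where "p1 = \<lbrakk>a1 \<cdot> a2, a3\<rbrakk> \<cdot> a4"
  define p2 where "p2 = \<lbrakk>a1 \<cdot> a2, a4\<rbrakk> \<cdot> a3"
  define p3 where "p3 = a1 \<cdot> \<lbrakk>a2, a3 \<cdot> a4\<rbrakk>"
  define p4 where "p4 = a2 \<cdot> \<lbrakk>a1, a3 \<cdot> a4\<rbrakk>"
  define n1 where "n1 = (a1 \<cdot> a3) \<cdot> \<lbrakk>a2, a4\<rbrakk>"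
  define n2 where "n2 = (a2 \<cdot> a3) \<cdot> \<lbrakk>a1, a4\<rbrakk>"
  define n3 where "n3 = (a2 \<cdot> a4) \<cdot> \<lbrakk>a1, a3\<rbrakk>"
  define n4 where "n4 = (a1 \<cdot> a4) \<cdot> \<lbrakk>a2, a3\<rbrakk>"
  define b1 where "b1 = \<lbrakk>a1 \<cdot> (a2 \<cdot> a4), a3\<rbrakk>"
  define b2 where "b2 = \<lbrakk>a1 \<cdot> (a2 \<cdot> a3), a4\<rbrakk>"
  define b3 where "b3 = \<lbrakk>a2, a1 \<cdot> (a3 \<cdot> a4)\<rbrakk>"
  define b4 where "b4 = \<lbrakk>a1, a2 \<cdot> (a3 \<cdot> a4)\<rbrakk>"
  note defs = L_def p1_def p2_def p3_def p4_def n1_def n2_def n3_def n4_def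
    b1_def b2_def b3_def b4_def
  have p1: "p1 + p1 = b1 + L"
    using double_mult_bracket[of a4 "a1 \<cdot> a2" a3] by (simp add: defs mult_ac)
  have p2: "p2 + p2 = b2 + L"
    using double_mult_bracket[of a3 "a1 \<cdot> a2" a4] by (simp add: defs mult_ac)
  have p3: "p3 + p3 = L + b3"
    using double_mult_bracket[of a1 a2 "a3 \<cdot> a4"] by (simp add: defs mult_ac)
  have p4: "p4 + p4 = L + b4"
    using double_mult_bracket[of a2 a1 "a3 \<cdot> a4"] by (simp add: defs mult_ac)
  have n3: "n3 + n3 = b1 + b4"
    using double_mult_bracket[of "a2 \<cdot> a4" a1 a3] by (simp add: defs mult_ac)
  have n1: "n1 + n1 = b2 + b3"
    using double_mult_bracket[of "a1 \<cdot> a3" a2 a4] by (simp add: defs mult_ac)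
  have L: "L = n3 + n1"
    using bracket_mult_mult[of a1 a2 a3 a4] by (simp add: defs mult_assoc)
  have L': "L = n2 + n4"
    using bracket_mult_mult[of a1 a2 a4 a3] by (simp add: defs mult_assoc mult_commute[of a4 a3])
  have "L = p1 + p2 + p3 + p4 - n1 - n2 - n3 - n4"
  proof (rule double_cancel)
    let ?R = "p1 + p2 + p3 + p4 - n1 - n2 - n3 - n4"
    have "?R + ?R = ((p1 + p1) + (p2 + p2) + (p3 + p3) + (p4 + p4))
        - ((n3 + n1) + (n2 + n4)) - ((n3 + n1) + (n2 + n4))"
      by (simp add: algebra_simps)
    also have "\<dots> = (b1 + b4) + (b2 + b3)"
      unfolding L[symmetric] L'[symmetric] p1 p2 p3 p4 by (simp add: algebra_simps)
    also have "\<dots> = (n3 + n1) + (n3 + n1)"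
      unfolding n1[symmetric] n3[symmetric] by (simp add: algebra_simps)
    finally show "L + L = ?R + ?R"
      unfolding L[symmetric] by simp
  qed
  then show ?thesis
    by (simp only: defs)
qed

end

theorem theorem3p2:
  fixes scale :: "'k::field_char_0 \<Rightarrow> 'a::ab_group_add \<Rightarrow> 'a"
    and mult bracket :: "'a \<Rightarrow> 'a \<Rightarrow> 'a"
  assumes "transposed_poisson_algebra scale mult bracket"
  shows "F_manifold_algebra scale mult bracket"
proof -
  interpret transposed_poisson_algebra scale mult bracket
    by (fact assms)
  show ?thesis
    by unfold_locales (rule hertling_manin_relation)
qed

end
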